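(* Let $a=x_0<x_1<\cdots<x_{2n}=b$ with $x_{i+1}=x_i+h$ for $i=0,1,\dots,2n-1$ and $h=(b-a)/(2n)$. Let $k\in\{2,3,4,5\}$. Suppose that for odd $j$, $1\le j\le 2n-1$: $f\in C^k(x_{j-1},x_{j+1})$; $\gamma_k,\Gamma_k$ are real numbers such that $\gamma_k\le f^{(k)}(x)\le\Gamma_k$ for $x\in[x_{j-1},x_{j+1}]$; and $$S_{k-1}=\frac{f^{(k-1)}(x_{j+1})-f^{(k-1)}(x_{j-1})}{x_{j+1}-x_{j-1}}.$$ Let $$\bar R_k(f)=\sum_{j=1,\ j\text{ odd}}^{2n-1}\int_{x_{j-1}}^{x_{j+1}}\bar T_{kj}(x)f^{(k)}(x)\,dx,$$ which is the remainder in $$\int_a^bf(x)\,dx=\frac h{15}\sum_{j=1,\ j\text{ odd}}^{2n-1}\left[7f(x_{j-1})+16f(x_j)+7f(x_{j+1})\right]-\frac{h^2}{15}\left[f'(b)-f'(a)\right]+\bar R_k(f).$$ Then $$|\bar R_k(f)|\le\frac{\Gamma_k-\gamma_k}4D_kh^k(b-a),$$ $$|\bar R_k(f)|\le\frac12(S_{k-1}-\gamma_k)E_kh^k(b-a),$$ $$|\bar R_k(f)|\le\frac12(\Gamma_k-S_{k-1})E_kh^k(b-a),$$ where $D_k=2^{k+1}C_k$, $E_k=2^{k+1}B_k$ and $$C_2=\frac{19\sqrt{19}}{10125},\quad C_3=\frac{253}{360000},\quad C_4=\frac1{14580},\quad C_5=\frac1{115200},$$ $$B_2=\frac1{40},\quad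 B_3=\frac7{20250}+\frac{19\sqrt{19}}{81000},\quad B_4=\frac1{5760},\quad B_5=\frac1{58320}.$$
   Context: The function $f$ is real-valued and $n\ge1$ is an integer. The numbers $\gamma_k,\Gamma_k,S_{k-1}$ carry no index $j$: the same $\gamma_k,\Gamma_k,S_{k-1}$ appear in the hypotheses for the panels $[x_{j-1},x_{j+1}]$ and in the conclusions. For odd $j\in\{1,3,\dots,2n-1\}$ the kernel is $\bar T_{kj}(x)=(-1)^k(2h)^kP_k\left(\frac{x-x_{j-1}}{2h}\right)$ for $x\in[x_{j-1},x_j]$ and $\bar T_{kj}(x)=(-1)^k(2h)^kQ_k\left(\frac{x-x_{j-1}}{2h}\right)$ for $x\in(x_j,x_{j+1}]$, where $P_2(x)=\frac12x^2-\frac7{30}x+\frac1{60}$, $Q_2(x)=\frac12x^2-\frac{23}{30}x+\frac{17}{60}$; $P_3(x)=\frac1{3!}x(x-\frac15)(x-\frac12)$, $Q_3(x)=\frac1{3!}(x-1)(x-\frac12)(x-\frac45)$; $P_4(x)=\frac1{4!}x^2(x-\frac13)(x-\frac35)$, $Q_4(x)=\frac1{4!}(x-1)^2(x-\frac23)(x-\frac25)$; $P_5(x)=\frac1{5!}x^3(x-\frac12)(x-\frac23)$, $Q_5(x)=\frac1{5!}(x-1)^3(x-\frac12)(x-\frac13)$. *)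

theory Defs
  imports "HOL-Analysis.Analysis"
begin

(* i-th derivative of f relative to S: on a nondegenerate compact interval it is the ordinary
   derivative at interior points and the one-sided derivative at the two endpoints. *)
primrec nderiv_within :: "real set \<Rightarrow> nat \<Rightarrow> (real \<Rightarrow> real) \<Rightarrow> real \<Rightarrow> real" where
  "nderiv_within S 0 f = f"
| "nderiv_within S (Suc i) f =
     (\<lambda>x. vector_derivative (nderiv_within S i f) (at x within S))"

(* f is C^k on the open interval (u, v); moreover f^(1), ..., f^(k) exist (one-sidedly) at u and v,
   where their values are used, but f^(k) need not be continuous there. *)
definition Ck_panel :: "nat \<Rightarrow> (real \<Rightarrow> real) \<Rightarrow> real \<Rightarrow> real \<Rightarrow> bool" where
  "Ck_panel k f u v \<longleftrightarrow>
     (\<forall>i<k. nderiv_within {u..v} i f differentiable_on {u..v}) \<and>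
     continuous_on {u<..<v} (nderiv_within {u..v} k f)"

(* The kernel polynomials and constants below are only used for 2 \<le> k \<le> 5;
   the value 0 for other k is a dummy. *)
definition kerP :: "nat \<Rightarrow> real \<Rightarrow> real" where
  "kerP k t =
     (if k = 2 then t^2 / 2 - 7/30 * t + 1/60
      else if k = 3 then 1 / fact 3 * t * (t - 1/5) * (t - 1/2)
      else if k = 4 then 1 / fact 4 * t^2 * (t - 1/3) * (t - 3/5)
      else if k = 5 then 1 / fact 5 * t^3 * (t - 1/2) * (t - 2/3)
      else 0)"

definition kerQ :: "nat \<Rightarrow> real \<Rightarrow> real" where
  "kerQ k t =
     (if k = 2 then t^2 / 2 - 23/30 * t + 17/60
      else if k = 3 then 1 / fact 3 * (t - 1) * (t - 1/2) * (t - 4/5)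
      else if k = 4 then 1 / fact 4 * (t - 1)^2 * (t - 2/3) * (t - 2/5)
      else if k = 5 then 1 / fact 5 * (t - 1)^3 * (t - 1/2) * (t - 1/3)
      else 0)"

definition kernelT :: "(nat \<Rightarrow> real) \<Rightarrow> real \<Rightarrow> nat \<Rightarrow> nat \<Rightarrow> real \<Rightarrow> real" where
  "kernelT x h k j t =
     (if t \<le> x j
      then (-1)^k * (2*h)^k * kerP k ((t - x (j - 1)) / (2*h))
      else (-1)^k * (2*h)^k * kerQ k ((t - x (j - 1)) / (2*h)))"

definition remainderR :: "nat \<Rightarrow> (nat \<Rightarrow> real) \<Rightarrow> real \<Rightarrow> nat \<Rightarrow> (real \<Rightarrow> real) \<Rightarrow> real" where
  "remainderR n x h k f =
     (\<Sum>j | j \<in> {1..2*n - 1} \<and> odd j.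
        integral {x (j - 1)..x (j + 1)}
          (\<lambda>t. kernelT x h k j t * nderiv_within {x (j - 1)..x (j + 1)} k f t))"

definition constB :: "nat \<Rightarrow> real" where
  "constB k =
     (if k = 2 then 1/40
      else if k = 3 then 7/20250 + 19 * sqrt 19 / 81000
      else if k = 4 then 1/5760
      else if k = 5 then 1/58320
      else 0)"

definition constC :: "nat \<Rightarrow> real" where
  "constC k =
     (if k = 2 then 19 * sqrt 19 / 10125
      else if k = 3 then 253/360000
      else if k = 4 then 1/14580
      else if k = 5 then 1/115200
      else 0)"

definition constD :: "nat \<Rightarrow> real" where
  "constD k = 2^(k + 1) * constC k"

definition constE :: "nat \<Rightarrow> real" where
  "constE k = 2^(k + 1) * constB k"

end

theory Submission
  imports Defs
begin

text \<open>
  Put \<open>w = 2 * h\<close> for the length of a panel \<open>[u, u + w]\<close>. On its two halves the kernels are, up to the factor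
  \<open>(- w)^k\<close>, rescaled polynomials \<open>P\<^sub>k\<close> and \<open>Q\<^sub>k\<close> that form two Appell sequences: \<open>P\<^sub>k\<close> is the
  derivative of \<open>P\<^sub>k\<^sub>+\<^sub>1\<close>, and likewise for \<open>Q\<close>. Both sequences extend down to degree 0, where
  \<open>P\<^sub>0 = Q\<^sub>0 = 1\<close>. Integration by parts therefore links the integrals of kernel times \<open>f^(k)\<close> for
  successive \<open>k\<close>, starting from the plain integral of \<open>f\<close>. The step from 0 to 1 produces the three
  point values, because \<open>P\<^sub>1\<close> and \<open>Q\<^sub>1\<close> do not agree at the midpoint; the step from 1 to 2 produces the
  first derivatives at the ends; the later steps produce nothing, because the kernels of degree 2 to 5
  are continuous at the midpoint and those of degree 3 to 5 vanish at the ends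
  (\<open>panel_by_parts\<close>, \<open>panel_quadrature\<close>). Summed over the panels, the derivative terms telescope.

  For the error bounds, the kernels with \<open>2 \<le> k \<le> 5\<close> have mean zero, so on a panel \<open>f^(k)\<close> may be
  replaced by \<open>f^(k) - c\<close> for any constant \<open>c\<close> (\<open>mean_zero_kernel_bounds\<close>). The midpoint of
  \<open>[\<gamma>, \<Gamma>]\<close> gives a bound by the \<open>L\<^sup>1\<close> norm of the kernel; \<open>c = \<gamma>\<close> and \<open>c = \<Gamma>\<close> give bounds by its
  maximum, because then \<open>f^(k) - c\<close> has constant sign and its integral is a difference of values of
  \<open>f^(k-1)\<close>. It remains to see that the \<open>L\<^sup>1\<close> norm on the unit panel is \<open>C\<^sub>k\<close>
  (\<open>has_integral_abs_unit_kernel\<close>) and that the maximum is at most \<open>B\<^sub>k\<close> (\<open>abs_unit_kernel_le\<close>).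
\<close>

section \<open>The kernel polynomials\<close>

text \<open>
  The explicit sum of divided powers continues the kernels to all degrees. Degrees 0 and 1 are where the
  integration by parts begins, and degree 6 is the antiderivative needed for the \<open>L\<^sup>1\<close> norm in degree 5.
  The coefficients are \<open>P\<^sub>1(0) = - 7/30\<close> and \<open>P\<^sub>2(0) = 1/60\<close>; all later constants of integration are 0.
\<close>

fun peano :: "nat \<Rightarrow> real \<Rightarrow> real" where
  "peano 0 s = 1"
| "peano (Suc 0) s = s - 7/30"
| "peano (Suc (Suc i)) s =
     s ^ (i + 2) / fact (i + 2) - 7/30 * (s ^ (i + 1) / fact (i + 1)) + 1/60 * (s ^ i / fact i)"

text \<open>
  The kernel on the right half is the mirror image of the one on the left half. The sign keeps it an
  Appell sequence, and it makes the whole kernel even or odd about the midpoint according to \<open>k\<close>.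
\<close>

definition peano_right :: "nat \<Rightarrow> real \<Rightarrow> real" where
  "peano_right k s = (-1) ^ k * peano k (1 - s)"

lemma kerP_eq_peano:
  assumes "k \<in> {2, 3, 4, 5}"
  shows "kerP k s = peano k s"
  using assms by (auto simp: kerP_def eval_nat_numeral field_simps)

lemma kerQ_eq_peano_right:
  assumes "k \<in> {2, 3, 4, 5}"
  shows "kerQ k s = peano_right k s"
  using assms by (auto simp: kerQ_def peano_right_def eval_nat_numeral field_simps)

lemma power_over_fact_has_derivative:
  "((\<lambda>s::real. s ^ Suc i / fact (Suc i)) has_real_derivative s ^ i / fact i) (at s within A)"
proof -
  have *: "((\<lambda>s::real. s ^ Suc i / fact (Suc i)) has_real_derivative (real (Suc i) * s ^ i) / fact (Suc i)) (at s within A)"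
    by (rule derivative_eq_intros refl | simp)+
  have "(real (Suc i) * s ^ i) / fact (Suc i) = s ^ i / fact i"
    by (simp add: field_simps del: of_nat_Suc)
  with * show ?thesis by simp
qed

lemma peano_has_derivative:
  "(peano (Suc k) has_real_derivative peano k s) (at s within A)"
proof -
  consider "k = 0" | "k = 1" | i where "k = Suc (Suc i)"
    by (metis One_nat_def not0_implies_Suc)
  then show ?thesis
  proof cases
    case 1
    then have "peano (Suc k) = (\<lambda>s. s - 7/30)" by (simp add: fun_eq_iff)
    then show ?thesis using 1 by (auto intro!: derivative_eq_intros)
  next
    case 2
    then have "peano (Suc k) = (\<lambda>s. s ^ 2 / 2 - 7/30 * s + 1/60)"
      by (simp add: fun_eq_iff eval_nat_numeral)
    then show ?thesis using 2 by (auto intro!: derivative_eq_intros)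
  next
    case (3 i)
    have "peano (Suc k) = (\<lambda>s. s ^ Suc (i + 2) / fact (Suc (i + 2))
            - 7/30 * (s ^ Suc (i + 1) / fact (Suc (i + 1))) + 1/60 * (s ^ Suc i / fact (Suc i)))"
      unfolding 3 by (rule ext) (simp add: eval_nat_numeral)
    moreover have "((\<lambda>s. s ^ Suc (i + 2) / fact (Suc (i + 2))
            - 7/30 * (s ^ Suc (i + 1) / fact (Suc (i + 1))) + 1/60 * (s ^ Suc i / fact (Suc i)))
       has_real_derivative s ^ (i + 2) / fact (i + 2)
            - 7/30 * (s ^ (i + 1) / fact (i + 1)) + 1/60 * (s ^ i / fact i)) (at s within A)"
      by (intro DERIV_add DERIV_diff DERIV_cmult power_over_fact_has_derivative)
    ultimately show ?thesis unfolding 3 by simp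
  qed
qed

lemma peano_right_has_derivative:
  "(peano_right (Suc k) has_real_derivative peano_right k s) (at s within A)"
proof -
  have "((\<lambda>s. peano (Suc k) (1 - s)) has_real_derivative peano k (1 - s) * (-1)) (at s within A)"
    by (rule DERIV_chain'[where f = "\<lambda>s. 1 - s" and g = "peano (Suc k)"])
       (auto intro!: derivative_eq_intros peano_has_derivative)
  from DERIV_cmult[OF this, of "(-1) ^ Suc k"] show ?thesis
    by (simp add: peano_right_def[abs_def])
qed

lemma continuous_on_peano: "continuous_on A (peano k)"
proof (cases k)
  case 0
  then have "peano k = (\<lambda>s. 1)" by (simp add: fun_eq_iff)
  then show ?thesis by simp
next
  case (Suc i)
  show ?thesis unfolding Suc by (rule DERIV_continuous_on) (rule peano_has_derivative)
qed

lemma continuous_on_peano_right: "continuous_on A (peano_right k)"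
  unfolding peano_right_def[abs_def]
  by (intro continuous_intros continuous_on_compose2[OF continuous_on_peano[of UNIV]]) auto

text \<open>
  The sign of \<open>- w\<close> is the one that integration by parts introduces, and the power of \<open>w\<close> compensates the
  chain rule, so that consecutive kernels on the panel are related without any constant.
\<close>

definition panel_kernel :: "(nat \<Rightarrow> real \<Rightarrow> real) \<Rightarrow> real \<Rightarrow> real \<Rightarrow> nat \<Rightarrow> real \<Rightarrow> real" where
  "panel_kernel p u w k t = (- w) ^ k * p k ((t - u) / w)"

lemma panel_kernel_has_derivative:
  assumes w: "w \<noteq> 0"
    and p: "\<And>s. (p (Suc k) has_real_derivative p k s) (at s)"
  shows "(panel_kernel p u w (Suc k) has_real_derivative - panel_kernel p u w k t) (at t within A)"
proof -
  have "((\<lambda>t. p (Suc k) ((t - u) / w)) has_real_derivative p k ((t - u) / w) * (1 / w)) (at t within A)"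
    by (rule DERIV_chain'[where f = "\<lambda>t. (t - u) / w" and g = "p (Suc k)"])
       (use w in \<open>auto intro!: derivative_eq_intros p\<close>)
  from DERIV_cmult[OF this, of "(- w) ^ Suc k"] show ?thesis
    using w by (simp add: panel_kernel_def[abs_def])
qed

section \<open>Integration by parts on a panel\<close>

text \<open>
  Integrability of the left-hand side is part of the conclusion: \<open>g'\<close> need not be continuous, but \<open>T g'\<close> is
  the derivative of \<open>T g\<close> plus a continuous function.
\<close>

lemma integration_by_parts_kernel:
  fixes T T' g g' :: "real \<Rightarrow> real"
  assumes "p \<le> q"
    and T: "\<And>t. (T has_real_derivative - T' t) (at t)"
    and T': "continuous_on {p..q} T'"
    and g: "\<And>t. t \<in> {p..q} \<Longrightarrow> (g has_real_derivative g' t) (at t within {p..q})"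
  shows "((\<lambda>t. T t * g' t) has_integral
           T q * g q - T p * g p + integral {p..q} (\<lambda>t. T' t * g t)) {p..q}"
proof -
  have cg: "continuous_on {p..q} g" using g by (rule DERIV_continuous_on)
  have "((\<lambda>t. T t * g' t + (- T' t) * g t) has_integral T q * g q - T p * g p) {p..q}"
    by (rule fundamental_theorem_of_calculus[OF \<open>p \<le> q\<close>])
       (auto simp flip: has_real_derivative_iff_has_vector_derivative
             intro!: derivative_eq_intros g has_field_derivative_at_within[OF T])
  moreover have "((\<lambda>t. T' t * g t) has_integral integral {p..q} (\<lambda>t. T' t * g t)) {p..q}"
    by (intro integrable_integral integrable_continuous_real continuous_intros T' cg)
  ultimately have "((\<lambda>t. (T t * g' t + (- T' t) * g t) + T' t * g t) has_integral
           T q * g q - T p * g p + integral {p..q} (\<lambda>t. T' t * g t)) {p..q}"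
    by (rule has_integral_add)
  then show ?thesis by simp
qed

lemma nderiv_within_has_derivative:
  assumes "Ck_panel k f u v" "i < k" "t \<in> {u..v}"
  shows "(nderiv_within {u..v} i f has_real_derivative nderiv_within {u..v} (Suc i) f t)
           (at t within {u..v})"
proof -
  have "nderiv_within {u..v} i f differentiable (at t within {u..v})"
    using assms by (auto simp: Ck_panel_def differentiable_on_def)
  then show ?thesis
    by (simp add: vector_derivative_works has_real_derivative_iff_has_vector_derivative)
qed

text \<open>
  The halves are integrated separately because for \<open>k = 1\<close> the two kernels disagree at the midpoint.
\<close>

definition panel_moment :: "(real \<Rightarrow> real) \<Rightarrow> real \<Rightarrow> real \<Rightarrow> nat \<Rightarrow> real" where
  "panel_moment f u w k =
     integral {u..u + w/2} (\<lambda>t. panel_kernel peano u w k t * nderiv_within {u..u + w} k f t) +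
     integral {u + w/2..u + w} (\<lambda>t. panel_kernel peano_right u w k t * nderiv_within {u..u + w} k f t)"

lemma continuous_on_panel_kernel:
  assumes "\<And>k. continuous_on UNIV (p k)"
  shows "continuous_on A (panel_kernel p u w k)"
  unfolding panel_kernel_def[abs_def]
  unfolding divide_inverse by (intro continuous_intros continuous_on_compose2[OF assms]) auto

text \<open>
  The boundary terms at the midpoint combine into the jump of the kernel there; this single recursion
  yields both the quadrature formula and the remainders.
\<close>

lemma panel_by_parts:
  assumes Ck: "Ck_panel k f u (u + w)" and "i < k" and w: "0 < w"
  defines "g \<equiv> \<lambda>i. nderiv_within {u..u + w} i f"
  shows "(\<lambda>t. panel_kernel peano u w (Suc i) t * g (Suc i) t) integrable_on {u..u + w/2}"
    and "(\<lambda>t. panel_kernel peano_right u w (Suc i) t * g (Suc i) t) integrable_on {u + w/2..u + w}"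
    and "panel_moment f u w (Suc i) = panel_moment f u w i
      + (-w) ^ Suc i * ((peano (Suc i) (1/2) - peano_right (Suc i) (1/2)) * g i (u + w/2)
          + peano_right (Suc i) 1 * g i (u + w) - peano (Suc i) 0 * g i u)"
proof -
  have der: "(g i has_real_derivative g (Suc i) t) (at t within A)"
    if "A \<subseteq> {u..u + w}" "t \<in> A" for t A
    using nderiv_within_has_derivative[OF Ck \<open>i < k\<close>] that unfolding g_def
    by (meson DERIV_subset subsetD)
  have L: "((\<lambda>t. panel_kernel peano u w (Suc i) t * g (Suc i) t) has_integral
        panel_kernel peano u w (Suc i) (u + w/2) * g i (u + w/2)
        - panel_kernel peano u w (Suc i) u * g i u
        + integral {u..u + w/2} (\<lambda>t. panel_kernel peano u w i t * g i t)) {u..u + w/2}"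
    by (rule integration_by_parts_kernel)
       (use w in \<open>auto intro!: panel_kernel_has_derivative peano_has_derivative der
          continuous_on_panel_kernel continuous_on_peano\<close>)
  have R: "((\<lambda>t. panel_kernel peano_right u w (Suc i) t * g (Suc i) t) has_integral
        panel_kernel peano_right u w (Suc i) (u + w) * g i (u + w)
        - panel_kernel peano_right u w (Suc i) (u + w/2) * g i (u + w/2)
        + integral {u + w/2..u + w} (\<lambda>t. panel_kernel peano_right u w i t * g i t)) {u + w/2..u + w}"
    by (rule integration_by_parts_kernel)
       (use w in \<open>auto intro!: panel_kernel_has_derivative peano_right_has_derivative der
          continuous_on_panel_kernel continuous_on_peano_right\<close>)
  show "(\<lambda>t. panel_kernel peano u w (Suc i) t * g (Suc i) t) integrable_on {u..u + w/2}"
    using L by blast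
  show "(\<lambda>t. panel_kernel peano_right u w (Suc i) t * g (Suc i) t) integrable_on {u + w/2..u + w}"
    using R by blast
  show "panel_moment f u w (Suc i) = panel_moment f u w i
      + (-w) ^ Suc i * ((peano (Suc i) (1/2) - peano_right (Suc i) (1/2)) * g i (u + w/2)
          + peano_right (Suc i) 1 * g i (u + w) - peano (Suc i) 0 * g i u)"
    using L[THEN integral_unique] R[THEN integral_unique] w
    unfolding panel_moment_def g_def by (simp add: panel_kernel_def algebra_simps)
qed

text \<open>
  The values at the ends carry the weights \<open>P\<^sub>1(0) = - 7/30\<close> and \<open>Q\<^sub>1(1) = 7/30\<close>, and the value at the
  midpoint carries the jump \<open>P\<^sub>1(1/2) - Q\<^sub>1(1/2) = 8/15\<close>.
\<close>

lemma panel_moment_1: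
  assumes "Ck_panel k f u (u + w)" "0 < k" "0 < w"
  shows "panel_moment f u w 1 =
    integral {u..u + w} f - w/30 * (7 * f u + 16 * f (u + w/2) + 7 * f (u + w))"
proof -
  have "continuous_on {u..u + w} f"
    using DERIV_continuous_on[OF nderiv_within_has_derivative[OF assms(1,2)]] by simp
  then have "f integrable_on {u..u + w}" by (rule integrable_continuous_real)
  then have "integral {u..u + w/2} f + integral {u + w/2..u + w} f = integral {u..u + w} f"
    using \<open>0 < w\<close> by (intro Henstock_Kurzweil_Integration.integral_combine) auto
  then have "panel_moment f u w 0 = integral {u..u + w} f"
    by (simp add: panel_moment_def panel_kernel_def peano_right_def)
  then show ?thesis
    using panel_by_parts(3)[OF assms(1,2,3)] by (simp add: peano_right_def algebra_simps)
qed

lemma panel_moment_2: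
  assumes "Ck_panel k f u (u + w)" "1 < k" "0 < w"
  defines "f' \<equiv> nderiv_within {u..u + w} 1 f"
  shows "panel_moment f u w 2 = panel_moment f u w 1 + w\<^sup>2 / 60 * (f' (u + w) - f' u)"
  using panel_by_parts(3)[OF assms(1,2,3)]
  by (simp add: peano_right_def f'_def algebra_simps eval_nat_numeral)

lemma peano_join:
  assumes "k \<in> {2, 3, 4, 5}"
  shows "peano k (1/2) = peano_right k (1/2)"
  using assms by (auto simp: peano_right_def eval_nat_numeral)

text \<open>
  From degree 3 on, the kernels vanish at both ends and have no jump at the midpoint.
\<close>

lemma panel_moment_higher:
  assumes "Ck_panel k f u (u + w)" "0 < w" "k \<in> {2, 3, 4, 5}"
  shows "panel_moment f u w k = panel_moment f u w 2"
proof -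
  have "panel_moment f u w (Suc i) = panel_moment f u w i" if "i < k" "i \<in> {2, 3, 4}" for i
  proof -
    have "peano (Suc i) (1/2) = peano_right (Suc i) (1/2)"
      using that by (intro peano_join) auto
    moreover have "peano_right (Suc i) 1 = 0" "peano (Suc i) 0 = 0"
      using that by (auto simp: peano_right_def eval_nat_numeral)
    ultimately show ?thesis
      using panel_by_parts(3)[OF assms(1) \<open>i < k\<close> assms(2)] by simp
  qed
  from this[of 2] this[of 3] this[of 4] assms(3) show ?thesis by auto
qed

lemma panel_quadrature:
  assumes Ck: "Ck_panel k f u (u + w)" and w: "0 < w" and k: "k \<in> {2, 3, 4, 5}"
  defines "f' \<equiv> nderiv_within {u..u + w} 1 f"
  shows "integral {u..u + w} f = w/30 * (7 * f u + 16 * f (u + w/2) + 7 * f (u + w))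
           - w\<^sup>2 / 60 * (f' (u + w) - f' u) + panel_moment f u w k"
  using panel_moment_1[OF Ck _ w] panel_moment_2[OF Ck _ w] panel_moment_higher[OF Ck w k] k
  by (auto simp: f'_def)

definition unit_kernel :: "nat \<Rightarrow> real \<Rightarrow> real" where
  "unit_kernel k s = (if s \<le> 1/2 then peano k s else peano_right k s)"

lemma unit_kernel_moment:
  assumes Ck: "Ck_panel k f u (u + w)" and w: "0 < w" and k: "k \<in> {2, 3, 4, 5}"
  shows "((\<lambda>t. (-w) ^ k * unit_kernel k ((t - u) / w) * nderiv_within {u..u + w} k f t)
           has_integral panel_moment f u w k) {u..u + w}"
proof -
  obtain i where i: "k = Suc i" "i < k" using k by (cases k) auto
  let ?F = "\<lambda>t. (-w) ^ k * unit_kernel k ((t - u) / w) * nderiv_within {u..u + w} k f t"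
  note ints = panel_by_parts(1,2)[OF Ck i(2) w, folded i(1), THEN integrable_integral]
  have "(?F has_integral integral {u..u + w/2}
          (\<lambda>t. panel_kernel peano u w k t * nderiv_within {u..u + w} k f t)) {u..u + w/2}"
    using w by (intro has_integral_eq[OF _ ints(1)])
      (auto simp: panel_kernel_def unit_kernel_def field_simps)
  moreover have "(?F has_integral integral {u + w/2..u + w}
          (\<lambda>t. panel_kernel peano_right u w k t * nderiv_within {u..u + w} k f t)) {u + w/2..u + w}"
  proof (rule has_integral_eq[OF _ ints(2)])
    fix t assume t: "t \<in> {u + w/2..u + w}"
    have "unit_kernel k ((t - u) / w) = peano_right k ((t - u) / w)"
    proof (cases "t = u + w/2")
      case True
      then show ?thesis using w peano_join[OF k] by (simp add: unit_kernel_def)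
    next
      case False
      then show ?thesis using w t by (simp add: unit_kernel_def field_simps)
    qed
    then show "panel_kernel peano_right u w k t * nderiv_within {u..u + w} k f t = ?F t"
      by (simp add: panel_kernel_def)
  qed
  ultimately show ?thesis
    unfolding panel_moment_def using w by (intro has_integral_combine) auto
qed

section \<open>Bounds for mean-zero kernels\<close>

text \<open>
  Since \<open>T\<close> integrates to 0, the integral of \<open>T g'\<close> equals that of \<open>T (g' - c)\<close> for every constant \<open>c\<close>. The
  first bound takes for \<open>c\<close> the midpoint of \<open>[\<gamma>, \<Gamma>]\<close>. The other two take an end of that interval, where
  \<open>g' - c\<close> has constant sign, so that the integral of its absolute value is known exactly.
\<close>

lemma mean_zero_kernel_bounds:
  fixes T g g' :: "real \<Rightarrow> real"
  assumes "u \<le> v"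
    and T0: "(T has_integral 0) {u..v}"
    and Tg: "((\<lambda>t. T t * g' t) has_integral I) {u..v}"
    and absT: "((\<lambda>t. \<bar>T t\<bar>) has_integral N) {u..v}"
    and M: "\<And>t. t \<in> {u..v} \<Longrightarrow> \<bar>T t\<bar> \<le> M"
    and g: "\<And>t. t \<in> {u..v} \<Longrightarrow> (g has_real_derivative g' t) (at t within {u..v})"
    and bounds: "\<And>t. t \<in> {u..v} \<Longrightarrow> \<gamma> \<le> g' t \<and> g' t \<le> \<Gamma>"
  shows "\<bar>I\<bar> \<le> (\<Gamma> - \<gamma>) / 2 * N"
    and "\<bar>I\<bar> \<le> M * (g v - g u - \<gamma> * (v - u))"
    and "\<bar>I\<bar> \<le> M * (\<Gamma> * (v - u) - (g v - g u))"
proof -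
  have shift: "((\<lambda>t. T t * (g' t - c)) has_integral I) {u..v}" for c
    using has_integral_diff[OF Tg has_integral_mult_right[OF T0, of c]]
    by (simp add: algebra_simps)
  have estimate: "\<bar>I\<bar> \<le> K"
    if "(B has_integral K) {u..v}" "\<And>t. t \<in> {u..v} \<Longrightarrow> \<bar>T t * (g' t - c)\<bar> \<le> B t" for B K c
    using shift that
    by (metis (no_types, lifting) has_integral_integrable integral_norm_bound_integral integral_unique
        real_norm_def)
  have FTC: "(g' has_integral g v - g u) {u..v}"
    using g by (intro fundamental_theorem_of_calculus[OF \<open>u \<le> v\<close>])
      (simp flip: has_real_derivative_iff_has_vector_derivative)
  have const: "((\<lambda>t. c) has_integral c * (v - u)) {u..v}" for c
    using has_integral_const_real[of c u v] \<open>u \<le> v\<close> by (simp add: mult.commute)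
  show "\<bar>I\<bar> \<le> (\<Gamma> - \<gamma>) / 2 * N"
  proof (rule estimate[where c = "(\<Gamma> + \<gamma>) / 2"])
    show "((\<lambda>t. (\<Gamma> - \<gamma>) / 2 * \<bar>T t\<bar>) has_integral (\<Gamma> - \<gamma>) / 2 * N) {u..v}"
      by (rule has_integral_mult_right[OF absT])
    fix t assume "t \<in> {u..v}"
    then have "\<bar>g' t - (\<Gamma> + \<gamma>) / 2\<bar> \<le> (\<Gamma> - \<gamma>) / 2"
      using bounds[of t] by (auto simp: abs_le_iff field_simps)
    then show "\<bar>T t * (g' t - (\<Gamma> + \<gamma>) / 2)\<bar> \<le> (\<Gamma> - \<gamma>) / 2 * \<bar>T t\<bar>"
      by (subst abs_mult, subst mult.commute) (rule mult_right_mono, auto)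
  qed
  show "\<bar>I\<bar> \<le> M * (g v - g u - \<gamma> * (v - u))"
    by (rule estimate[where c = \<gamma>, OF has_integral_mult_right[OF has_integral_diff[OF FTC const]]])
       (use M bounds in \<open>auto simp: abs_mult intro!: mult_mono\<close>, smt (verit) M atLeastAtMost_iff)
  show "\<bar>I\<bar> \<le> M * (\<Gamma> * (v - u) - (g v - g u))"
    by (rule estimate[where c = \<Gamma>, OF has_integral_mult_right[OF has_integral_diff[OF const FTC]]])
       (use M bounds in \<open>auto simp: abs_mult intro!: mult_mono\<close>, smt (verit) M atLeastAtMost_iff)
qed

section \<open>Norms of the kernels on the unit panel\<close>

lemma peano_factored:
  "peano 2 s = (s - (7 - sqrt 19) / 30) * (s - (7 + sqrt 19) / 30) / 2"
  "peano 3 s = s * (1/5 - s) * (1/2 - s) / 6"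
  "peano 4 s = s\<^sup>2 * (1/3 - s) * (3/5 - s) / 24"
  "peano 5 s = s ^ 3 * (1/2 - s) * (2/3 - s) / 120"
proof -
  have "sqrt 19 * sqrt 19 = 19" by simp
  then show "peano 2 s = (s - (7 - sqrt 19) / 30) * (s - (7 + sqrt 19) / 30) / 2"
    by (simp add: eval_nat_numeral field_simps)
qed (simp_all add: kerP_eq_peano[symmetric] kerP_def eval_nat_numeral field_simps)

lemma peano_sign:
  assumes "0 \<le> s" "s \<le> 1/2"
  shows "s \<le> 1/5 \<Longrightarrow> 0 \<le> peano 3 s"
    and "1/5 \<le> s \<Longrightarrow> peano 3 s \<le> 0"
    and "s \<le> 1/3 \<Longrightarrow> 0 \<le> peano 4 s"
    and "1/3 \<le> s \<Longrightarrow> peano 4 s \<le> 0"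
    and "0 \<le> peano 5 s"
  unfolding peano_factored using assms
  by (auto intro!: divide_nonpos_pos mult_nonpos_nonneg[OF mult_nonneg_nonpos])

lemma sqrt_19_bounds: "4 < sqrt 19" "sqrt 19 < 5"
  by (auto intro: real_less_rsqrt real_less_lsqrt)

lemma unit_kernel_reflect:
  assumes "k \<in> {2, 3, 4, 5}"
  shows "unit_kernel k (1 - s) = (-1) ^ k * unit_kernel k s"
proof -
  consider "s < 1/2" | "s = 1/2" | "s > 1/2" by linarith
  then show ?thesis
  proof cases
    case 2
    show ?thesis unfolding 2 using assms by (auto simp: unit_kernel_def eval_nat_numeral)
  qed (auto simp: unit_kernel_def peano_right_def)
qed

lemma has_integral_reflect_half:
  fixes f :: "real \<Rightarrow> real"
  assumes "(f has_integral I) {0..1/2}"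
  shows "((\<lambda>s. f (1 - s)) has_integral I) {1/2..1}"
proof -
  have "(\<lambda>s::real. 1 - s) ` {0..1/2} = {1/2..1}"
    by (simp add: image_diff_atLeastAtMost)
  then show ?thesis
    using has_integral_affinity[of f I 0 "1/2" "-1" 1] assms by simp
qed

lemma has_integral_peano:
  assumes "p \<le> q"
  shows "(peano k has_integral peano (Suc k) q - peano (Suc k) p) {p..q}"
  using assms peano_has_derivative
  by (intro fundamental_theorem_of_calculus)
     (auto simp flip: has_real_derivative_iff_has_vector_derivative)

text \<open>
  For odd \<open>k\<close> the two halves cancel by antisymmetry. For even \<open>k\<close> each half integrates to 0, because
  \<open>P\<^sub>k\<^sub>+\<^sub>1\<close> vanishes at 0 and at 1/2.
\<close>

lemma unit_kernel_mean_zero: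
  assumes k: "k \<in> {2, 3, 4, 5}"
  shows "(unit_kernel k has_integral 0) {0..1}"
proof -
  let ?A = "peano (Suc k) (1/2) - peano (Suc k) 0"
  have left: "(unit_kernel k has_integral ?A) {0..1/2}"
    by (rule has_integral_eq[OF _ has_integral_peano]) (auto simp: unit_kernel_def)
  have "((\<lambda>s. (-1) ^ k * unit_kernel k (1 - s)) has_integral (-1) ^ k * ?A) {1/2..1}"
    by (intro has_integral_mult_right has_integral_reflect_half left)
  then have "(unit_kernel k has_integral (-1) ^ k * ?A) {1/2..1}"
    by (simp add: unit_kernel_reflect[OF k])
  with left have "(unit_kernel k has_integral ?A + (-1) ^ k * ?A) {0..1}"
    by (intro has_integral_combine[where c = "1/2"]) auto
  moreover have "?A + (-1) ^ k * ?A = 0"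
    using k by (auto simp: eval_nat_numeral)
  ultimately show ?thesis by simp
qed

lemma has_integral_abs_peano:
  assumes "p \<le> q"
  shows "(\<And>s. p \<le> s \<Longrightarrow> s \<le> q \<Longrightarrow> 0 \<le> peano k s) \<Longrightarrow>
           ((\<lambda>s. \<bar>peano k s\<bar>) has_integral peano (Suc k) q - peano (Suc k) p) {p..q}"
    and "(\<And>s. p \<le> s \<Longrightarrow> s \<le> q \<Longrightarrow> peano k s \<le> 0) \<Longrightarrow>
           ((\<lambda>s. \<bar>peano k s\<bar>) has_integral peano (Suc k) p - peano (Suc k) q) {p..q}"
proof -
  show "((\<lambda>s. \<bar>peano k s\<bar>) has_integral peano (Suc k) q - peano (Suc k) p) {p..q}"
    if "\<And>s. p \<le> s \<Longrightarrow> s \<le> q \<Longrightarrow> 0 \<le> peano k s"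
  proof (rule has_integral_eq[OF _ has_integral_peano[OF assms]])
    show "peano k s = \<bar>peano k s\<bar>" if "s \<in> {p..q}" for s
      using \<open>\<And>s. p \<le> s \<Longrightarrow> s \<le> q \<Longrightarrow> 0 \<le> peano k s\<close>[of s] that by simp
  qed
  show "((\<lambda>s. \<bar>peano k s\<bar>) has_integral peano (Suc k) p - peano (Suc k) q) {p..q}"
    if "\<And>s. p \<le> s \<Longrightarrow> s \<le> q \<Longrightarrow> peano k s \<le> 0"
  proof (rule has_integral_eq)
    show "((\<lambda>s. - peano k s) has_integral peano (Suc k) p - peano (Suc k) q) {p..q}"
      using has_integral_neg[OF has_integral_peano[OF assms, of k]] by simp
    show "- peano k s = \<bar>peano k s\<bar>" if "s \<in> {p..q}" for s
      using \<open>\<And>s. p \<le> s \<Longrightarrow> s \<le> q \<Longrightarrow> peano k s \<le> 0\<close>[of s] that by simp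
  qed
qed

text \<open>
  The interval \<open>[0, 1/2]\<close> is cut at the sign changes of \<open>P\<^sub>k\<close>: at \<open>(7 - sqrt 19)/30\<close> and
  \<open>(7 + sqrt 19)/30\<close> for \<open>k = 2\<close>, at 1/5 for \<open>k = 3\<close>, at 1/3 for \<open>k = 4\<close>, and nowhere for \<open>k = 5\<close>.
\<close>

lemma has_integral_abs_peano_half:
  assumes "k \<in> {2, 3, 4, 5}"
  shows "((\<lambda>s. \<bar>peano k s\<bar>) has_integral constC k / 2) {0..1/2}"
proof -
  have "((\<lambda>s. \<bar>peano 2 s\<bar>) has_integral constC 2 / 2) {0..1/2}"
  proof -
    define q where "q = sqrt 19"
    have q: "4 < q" "q < 5"
      using sqrt_19_bounds by (simp_all add: q_def)
    \<comment> \<open>These are the roots of \<open>P\<^sub>2\<close>, both in \<open>[0, 1/2]\<close>.\<close>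
    define r r' where "r = (7 - q) / 30" and "r' = (7 + q) / 30"
    have r: "0 \<le> r" "r \<le> r'" "r' \<le> 1/2" using q by (simp_all add: r_def r'_def)
    have P: "peano 2 s = (s - r) * (s - r') / 2" for s
      by (simp add: peano_factored r_def r'_def q_def)
    have "((\<lambda>s. \<bar>peano 2 s\<bar>) has_integral peano 3 r - peano 3 0) {0..r}"
      using has_integral_abs_peano(1)[of 0 r 2] r
      by (simp add: P mult_nonpos_nonpos)
    moreover have "((\<lambda>s. \<bar>peano 2 s\<bar>) has_integral peano 3 r - peano 3 r') {r..r'}"
      using has_integral_abs_peano(2)[of r r' 2] r
      by (simp add: P mult_nonneg_nonpos)
    moreover have "((\<lambda>s. \<bar>peano 2 s\<bar>) has_integral peano 3 (1/2) - peano 3 r') {r'..1/2}"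
      using has_integral_abs_peano(1)[of r' "1/2" 2] r
      by (simp add: P)
    ultimately have "((\<lambda>s. \<bar>peano 2 s\<bar>) has_integral
        (peano 3 r - peano 3 0) + ((peano 3 r - peano 3 r') + (peano 3 (1/2) - peano 3 r'))) {0..1/2}"
      using r by (intro has_integral_combine[of 0 r "1/2"] has_integral_combine[of r r' "1/2"]) auto
    moreover have "(peano 3 r - peano 3 0) + ((peano 3 r - peano 3 r') + (peano 3 (1/2) - peano 3 r'))
        = constC 2 / 2"
    proof -
      have "peano 3 r - peano 3 r' = 19 * q / 40500"
        unfolding peano_factored r_def r'_def by (simp add: field_simps) (simp add: q_def)
      then show ?thesis
        by (simp add: peano_factored constC_def flip: q_def)
    qed
    ultimately show ?thesis by (simp only:)
  qed
  moreover have "((\<lambda>s. \<bar>peano 3 s\<bar>) has_integral constC 3 / 2) {0..1/2}"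
  proof -
    have "((\<lambda>s. \<bar>peano 3 s\<bar>) has_integral peano 4 (1/5) - peano 4 0) {0..1/5}"
      using has_integral_abs_peano(1)[of 0 "1/5" 3] peano_sign(1) by simp
    moreover have "((\<lambda>s. \<bar>peano 3 s\<bar>) has_integral peano 4 (1/5) - peano 4 (1/2)) {1/5..1/2}"
      using has_integral_abs_peano(2)[of "1/5" "1/2" 3] peano_sign(2) by simp
    ultimately have "((\<lambda>s. \<bar>peano 3 s\<bar>) has_integral
        (peano 4 (1/5) - peano 4 0) + (peano 4 (1/5) - peano 4 (1/2))) {0..1/2}"
      by (intro has_integral_combine[of 0 "1/5" "1/2"]) auto
    then show ?thesis by (simp add: peano_factored constC_def power2_eq_square)
  qed
  moreover have "((\<lambda>s. \<bar>peano 4 s\<bar>) has_integral constC 4 / 2) {0..1/2}"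
  proof -
    have "((\<lambda>s. \<bar>peano 4 s\<bar>) has_integral peano 5 (1/3) - peano 5 0) {0..1/3}"
      using has_integral_abs_peano(1)[of 0 "1/3" 4] peano_sign(3) by simp
    moreover have "((\<lambda>s. \<bar>peano 4 s\<bar>) has_integral peano 5 (1/3) - peano 5 (1/2)) {1/3..1/2}"
      using has_integral_abs_peano(2)[of "1/3" "1/2" 4] peano_sign(4) by simp
    ultimately have "((\<lambda>s. \<bar>peano 4 s\<bar>) has_integral
        (peano 5 (1/3) - peano 5 0) + (peano 5 (1/3) - peano 5 (1/2))) {0..1/2}"
      by (intro has_integral_combine[of 0 "1/3" "1/2"]) auto
    then show ?thesis by (simp add: peano_factored constC_def power3_eq_cube)
  qed
  moreover have "((\<lambda>s. \<bar>peano 5 s\<bar>) has_integral constC 5 / 2) {0..1/2}"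
  proof -
    have "((\<lambda>s. \<bar>peano 5 s\<bar>) has_integral peano 6 (1/2) - peano 6 0) {0..1/2}"
      using has_integral_abs_peano(1)[of 0 "1/2" 5] peano_sign(5) by simp
    then show ?thesis by (simp add: constC_def eval_nat_numeral)
  qed
  ultimately show ?thesis using assms by blast
qed

lemma abs_unit_kernel:
  assumes "k \<in> {2, 3, 4, 5}"
  shows "\<bar>unit_kernel k (1 - s)\<bar> = \<bar>unit_kernel k s\<bar>"
  by (simp add: unit_kernel_reflect[OF assms] abs_mult power_abs)

lemma has_integral_abs_unit_kernel:
  assumes k: "k \<in> {2, 3, 4, 5}"
  shows "((\<lambda>s. \<bar>unit_kernel k s\<bar>) has_integral constC k) {0..1}"
proof -
  have left: "((\<lambda>s. \<bar>unit_kernel k s\<bar>) has_integral constC k / 2) {0..1/2}"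
    by (rule has_integral_eq[OF _ has_integral_abs_peano_half[OF k]]) (auto simp: unit_kernel_def)
  from has_integral_reflect_half[OF this]
  have "((\<lambda>s. \<bar>unit_kernel k s\<bar>) has_integral constC k / 2) {1/2..1}"
    by (simp add: abs_unit_kernel[OF k])
  with left have "((\<lambda>s. \<bar>unit_kernel k s\<bar>) has_integral constC k / 2 + constC k / 2) {0..1}"
    by (intro has_integral_combine[where c = "1/2"]) auto
  then show ?thesis by simp
qed

text \<open>
  Each bound is the absolute value of \<open>P\<^sub>k\<close> at a point \<open>m\<close> of \<open>[0, 1/2]\<close>: \<open>m = 1/2\<close> for \<open>k = 2\<close> and
  \<open>k = 4\<close>, \<open>m = (7 + sqrt 19)/30\<close> for \<open>k = 3\<close> and \<open>m = 1/3\<close> for \<open>k = 5\<close>. For \<open>k \<ge> 3\<close> this \<open>m\<close> is a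
  zero of \<open>P\<^sub>k\<^sub>-\<^sub>1\<close>, the derivative of \<open>P\<^sub>k\<close>. Hence \<open>P\<^sub>k(s) - P\<^sub>k(m)\<close> has the factor \<open>(s - m)\<^sup>2\<close>,
  and the cofactor visibly has constant sign. The extremum of the opposite sign, where there is one, is
  smaller, and crude estimates suffice for it.
\<close>

lemma abs_peano_le:
  assumes k: "k \<in> {2, 3, 4, 5}" and s: "0 \<le> s" "s \<le> 1/2"
  shows "\<bar>peano k s\<bar> \<le> constB k"
proof -
  have "\<bar>peano 2 s\<bar> \<le> 1/40"
  proof -
    \<comment> \<open>The minimum \<open>- 19/1800\<close>, at the vertex of the parabola, is smaller in modulus than 1/40.\<close>
    have "peano 2 s = (s - 7/30)\<^sup>2 / 2 - 19/1800"
      by (simp add: kerP_eq_peano[symmetric] kerP_def power2_eq_square field_simps)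
    then have "- (1/40) \<le> peano 2 s" using zero_le_power2[of "s - 7/30"] by linarith
    moreover have "1/40 - peano 2 s = (1/2 - s) * (s / 2 + 1/60)"
      by (simp add: kerP_eq_peano[symmetric] kerP_def power2_eq_square field_simps)
    then have "0 \<le> 1/40 - peano 2 s" using s by simp
    ultimately show ?thesis by linarith
  qed
  moreover have "\<bar>peano 3 s\<bar> \<le> 7/20250 + 19 * sqrt 19 / 81000"
  proof -
    define q where "q = sqrt 19"
    have q: "4 < q" "q < 5"
      using sqrt_19_bounds by (simp_all add: q_def)
    have qq: "q * (q * z) = 19 * z" for z
      by (simp add: q_def flip: mult.assoc)
    have "(30 * s - 7 - q)\<^sup>2 * (30 * s + 2 * q - 7) = 162000 * (s * (1/5 - s) * (1/2 - s) / 6) + 56 + 38 * q"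
      by (simp add: power2_eq_square field_simps) (simp add: qq)
    then have "peano 3 s + (7/20250 + 19 * q / 81000)
        = (30 * s - 7 - q)\<^sup>2 * (30 * s + 2 * q - 7) / 162000"
      unfolding peano_factored by linarith
    moreover have "\<dots> \<ge> 0" using q s by simp
    \<comment> \<open>The simple bound 1/1200 is already below the target, as \<open>sqrt 19 > 4\<close>.\<close>
    moreover have "peano 3 s \<le> 1/1200"
    proof (cases "s \<le> 1/5")
      case True
      have "s * (1/5 - s) \<le> 1/100"
        using zero_le_power2[of "s - 1/10"] by (simp add: power2_eq_square algebra_simps)
      then have "s * (1/5 - s) * (1/2 - s) \<le> 1/100 * (1/2)"
        using s True by (intro mult_mono) auto
      then show ?thesis by (simp add: peano_factored algebra_simps)
    next
      case False
      then have "peano 3 s \<le> 0" using s by (intro peano_sign(2)) auto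
      then show ?thesis by linarith
    qed
    ultimately show ?thesis using q(1) unfolding q_def[symmetric] abs_le_iff by linarith
  qed
  moreover have "\<bar>peano 4 s\<bar> \<le> 1/5760"
  proof -
    have "peano 4 s + 1/5760 = (s - 1/2)\<^sup>2 * (s\<^sup>2 + s / 15 + 1/60) / 24"
      by (simp add: peano_factored power2_eq_square field_simps)
    moreover have "\<dots> \<ge> 0" using s by simp
    moreover have "peano 4 s \<le> 1/5760"
    proof (cases "s \<le> 1/3")
      case True
      \<comment> \<open>The factor \<open>s\<^sup>2\<close> is split so that each product is largest midway between its two zeros.\<close>
      have "s * (1/3 - s) \<le> 1/36"
        using zero_le_power2[of "s - 1/6"] by (simp add: power2_eq_square algebra_simps)
      moreover have "s * (3/5 - s) \<le> 9/100"
        using zero_le_power2[of "s - 3/10"] by (simp add: power2_eq_square algebra_simps)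
      ultimately have "(s * (1/3 - s)) * (s * (3/5 - s)) \<le> 1/36 * (9/100)"
        using s True by (intro mult_mono) auto
      moreover have "peano 4 s = (s * (1/3 - s)) * (s * (3/5 - s)) / 24"
        by (simp add: peano_factored power2_eq_square)
      ultimately show ?thesis by linarith
    next
      case False
      then have "peano 4 s \<le> 0" using s by (intro peano_sign(4)) auto
      then show ?thesis by linarith
    qed
    ultimately show ?thesis by linarith
  qed
  moreover have "\<bar>peano 5 s\<bar> \<le> 1/58320"
  proof -
    have "1/58320 - peano 5 s = (s - 1/3)\<^sup>2 * (s\<^sup>2 * (1/2 - s) + s / 9 + 1/54) / 120"
      by (simp add: peano_factored power2_eq_square power3_eq_cube field_simps)
    moreover have "\<dots> \<ge> 0" using s by simp
    moreover have "0 \<le> peano 5 s"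
      using s by (rule peano_sign(5))
    ultimately show ?thesis by linarith
  qed
  ultimately show ?thesis using k by (auto simp: constB_def)
qed

lemma abs_unit_kernel_le:
  assumes k: "k \<in> {2, 3, 4, 5}" and "0 \<le> s" "s \<le> 1"
  shows "\<bar>unit_kernel k s\<bar> \<le> constB k"
proof (cases "s \<le> 1/2")
  case True
  then show ?thesis using abs_peano_le[OF k \<open>0 \<le> s\<close>] by (simp add: unit_kernel_def)
next
  case False
  then show ?thesis
    using abs_peano_le[OF k, of "1 - s"] assms abs_unit_kernel[OF k, of s]
    by (simp add: unit_kernel_def)
qed

lemma has_integral_unit_to_panel:
  fixes f :: "real \<Rightarrow> real"
  assumes "(f has_integral I) {0..1}" and w: "0 < w"
  shows "((\<lambda>t. f ((t - u) / w)) has_integral w * I) {u..u + w}"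
proof -
  have "(\<lambda>s. w * s + u) ` {0..1} = {u..u + w}"
    using w by (subst image_affinity_atLeastAtMost) (simp add: add.commute)
  then show ?thesis
    using has_integral_affinity[of f I 0 1 "1 / w" "- u / w"] assms
    by (simp add: diff_divide_distrib)
qed

text \<open>
  The three bounds scaled from the unit panel: the kernel gains the factor \<open>w^k\<close> and its
  \<open>L\<^sup>1\<close> norm a further \<open>w\<close> from the change of variable.
\<close>

lemma panel_moment_bounds:
  assumes Ck: "Ck_panel k f u (u + w)" and w: "0 < w" and k: "k \<in> {2, 3, 4, 5}"
    and bounds: "\<And>t. t \<in> {u..u + w} \<Longrightarrow>
      \<gamma> \<le> nderiv_within {u..u + w} k f t \<and> nderiv_within {u..u + w} k f t \<le> \<Gamma>"
  defines "g \<equiv> nderiv_within {u..u + w} (k - 1) f"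
  shows "\<bar>panel_moment f u w k\<bar> \<le> (\<Gamma> - \<gamma>) / 2 * (w ^ k * (w * constC k))"
    and "\<bar>panel_moment f u w k\<bar> \<le> w ^ k * constB k * (g (u + w) - g u - \<gamma> * w)"
    and "\<bar>panel_moment f u w k\<bar> \<le> w ^ k * constB k * (\<Gamma> * w - (g (u + w) - g u))"
proof -
  let ?T = "\<lambda>t. (-w) ^ k * unit_kernel k ((t - u) / w)"
  have le: "u \<le> u + w" using w by simp
  have zero: "(?T has_integral 0) {u..u + w}"
    using has_integral_mult_right[OF has_integral_unit_to_panel[OF unit_kernel_mean_zero[OF k] w]]
    by simp
  have prod: "((\<lambda>t. ?T t * nderiv_within {u..u + w} k f t) has_integral panel_moment f u w k) {u..u + w}"
    by (rule unit_kernel_moment[OF Ck w k])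
  have abs: "((\<lambda>t. \<bar>?T t\<bar>) has_integral w ^ k * (w * constC k)) {u..u + w}"
    using has_integral_mult_right[OF has_integral_unit_to_panel[OF has_integral_abs_unit_kernel[OF k] w],
        of "w ^ k"] w
    by (simp add: abs_mult power_abs)
  have max: "\<bar>?T t\<bar> \<le> w ^ k * constB k" if "t \<in> {u..u + w}" for t
    using that w abs_unit_kernel_le[OF k, of "(t - u) / w"]
    by (simp add: abs_mult power_abs)
  have der: "(g has_real_derivative nderiv_within {u..u + w} k f t) (at t within {u..u + w})"
    if "t \<in> {u..u + w}" for t
  proof -
    obtain i where "k = Suc i" using k by (cases k) auto
    then show ?thesis using nderiv_within_has_derivative[OF Ck _ that, of i] by (simp add: g_def)
  qed
  note estimates = mean_zero_kernel_bounds[OF le zero prod abs max der bounds, unfolded add_diff_cancel_left']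
  show "\<bar>panel_moment f u w k\<bar> \<le> (\<Gamma> - \<gamma>) / 2 * (w ^ k * (w * constC k))"
    by (rule estimates(1))
  show "\<bar>panel_moment f u w k\<bar> \<le> w ^ k * constB k * (g (u + w) - g u - \<gamma> * w)"
    by (rule estimates(2))
  show "\<bar>panel_moment f u w k\<bar> \<le> w ^ k * constB k * (\<Gamma> * w - (g (u + w) - g u))"
    by (rule estimates(3))
qed

section \<open>Summation over the panels\<close>

lemma sum_odd_indices:
  fixes F :: "nat \<Rightarrow> real"
  shows "(\<Sum>j | j \<in> {1..2*n - 1} \<and> odd j. F j) = (\<Sum>i<n. F (2*i + 1))"
proof -
  have "{j. j \<in> {1..2*n - 1} \<and> odd j} = (\<lambda>i. 2*i + 1) ` {..<n}"
    by (auto elim!: oddE)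
  then show ?thesis by (simp add: sum.reindex inj_on_def)
qed

text \<open>
  This is what makes the one-sided derivatives of adjacent panels agree at their common node, so that
  the boundary terms telescope.
\<close>

lemma nderiv_within_1_subinterval:
  assumes "f differentiable_on {a..b}" "{u..v} \<subseteq> {a..b}" "u < v" "t \<in> {u..v}"
  shows "nderiv_within {u..v} 1 f t = nderiv_within {a..b} 1 f t"
proof -
  have "(f has_vector_derivative vector_derivative f (at t within {a..b})) (at t within {a..b})"
    using assms by (auto simp: differentiable_on_def simp flip: vector_derivative_works)
  then have "(f has_vector_derivative vector_derivative f (at t within {a..b})) (at t within {u..v})"
    using assms(2) by (rule has_vector_derivative_within_subset)
  then show ?thesis
    using assms(3,4) by (simp add: vector_derivative_within_closed_interval)
qed

lemma integral_sum_panels: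
  fixes f :: "real \<Rightarrow> real"
  assumes "f integrable_on {a..a + real n * w}" "0 \<le> w"
  shows "integral {a..a + real n * w} f = (\<Sum>i<n. integral {a + real i * w..a + real (Suc i) * w} f)"
  using assms(1)
proof (induction n)
  case (Suc n)
  have le: "a \<le> a + real n * w" "a + real n * w \<le> a + real (Suc n) * w"
    using \<open>0 \<le> w\<close> by (auto intro: mult_right_mono)
  have "f integrable_on {a..a + real n * w}"
    using Suc.prems le by (elim integrable_subinterval_real) auto
  with Suc.IH Henstock_Kurzweil_Integration.integral_combine[OF le Suc.prems] show ?case
    by simp
qed simp

(* The derivatives of f are taken panel by panel, so f' may have jumps at the even nodes. The error
   bounds hold regardless; the quadrature formula, in which only f'(a) and f'(b) survive, needs f to
   be differentiable on the whole of [a, b]. *)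
theorem theorem8:
  fixes f :: "real \<Rightarrow> real" and x :: "nat \<Rightarrow> real"
    and a b h \<gamma> \<Gamma> S :: real and n k :: nat
  assumes n: "n \<ge> 1"
    and ends: "x 0 = a" "x (2*n) = b"
    and incr: "\<And>i. i < 2*n \<Longrightarrow> x i < x (i + 1)"
    and step: "\<And>i. i < 2*n \<Longrightarrow> x (i + 1) = x i + h"
    and h: "h = (b - a) / (2 * real n)"
    and k: "k \<in> {2, 3, 4, 5}"
    and smooth: "\<And>j. \<lbrakk>odd j; 1 \<le> j; j \<le> 2*n - 1\<rbrakk> \<Longrightarrow> Ck_panel k f (x (j - 1)) (x (j + 1))"
    and bounds: "\<And>j t. \<lbrakk>odd j; 1 \<le> j; j \<le> 2*n - 1; t \<in> {x (j - 1)..x (j + 1)}\<rbrakk> \<Longrightarrow>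
        \<gamma> \<le> nderiv_within {x (j - 1)..x (j + 1)} k f t \<and>
        nderiv_within {x (j - 1)..x (j + 1)} k f t \<le> \<Gamma>"
    and S: "\<And>j. \<lbrakk>odd j; 1 \<le> j; j \<le> 2*n - 1\<rbrakk> \<Longrightarrow>
        S = (nderiv_within {x (j - 1)..x (j + 1)} (k - 1) f (x (j + 1))
             - nderiv_within {x (j - 1)..x (j + 1)} (k - 1) f (x (j - 1)))
            / (x (j + 1) - x (j - 1))"
  shows "(f differentiable_on {a..b} \<longrightarrow>
           integral {a..b} f =
             h / 15 * (\<Sum>j | j \<in> {1..2*n - 1} \<and> odd j. 7 * f (x (j - 1)) + 16 * f (x j) + 7 * f (x (j + 1)))
             - h^2 / 15 * (nderiv_within {a..b} 1 f b - nderiv_within {a..b} 1 f a)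
             + remainderR n x h k f)
       \<and> \<bar>remainderR n x h k f\<bar> \<le> (\<Gamma> - \<gamma>) / 4 * constD k * h^k * (b - a)
       \<and> \<bar>remainderR n x h k f\<bar> \<le> 1/2 * (S - \<gamma>) * constE k * h^k * (b - a)
       \<and> \<bar>remainderR n x h k f\<bar> \<le> 1/2 * (\<Gamma> - S) * constE k * h^k * (b - a)"
proof -
  have hpos: "0 < h" using incr[of 0] step[of 0] n by simp
  have xi: "x i = a + real i * h" if "i \<le> 2*n" for i
    using that
  proof (induction i)
    case (Suc i)
    then show ?case using step[of i] by (simp add: algebra_simps)
  qed (simp add: ends)
  define w where "w = 2 * h"
  define u where "u i = a + real i * w" for i
  have w: "0 < w" using hpos by (simp add: w_def)
  have ba: "b = a + real n * w" using h n by (simp add: w_def field_simps)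
  have nodes: "x (2*i) = u i" "x (2*i + 1) = u i + w/2" "x (2*i + 2) = u i + w"
    if "i < n" for i
    using that by (simp_all add: xi u_def w_def algebra_simps)
  have u_Suc: "u (Suc i) = u i + w" for i by (simp add: u_def algebra_simps)
  let ?g = "\<lambda>i l. nderiv_within {u i..u i + w} l f"
  have Ck: "Ck_panel k f (u i) (u i + w)" if "i < n" for i
    using smooth[of "2*i + 1"] nodes[OF that] that by simp
  have bd: "\<gamma> \<le> ?g i k t \<and> ?g i k t \<le> \<Gamma>" if "i < n" "t \<in> {u i..u i + w}" for i t
    using bounds[of "2*i + 1" t] nodes[OF that(1)] that by simp
  have S': "?g i (k - 1) (u i + w) - ?g i (k - 1) (u i) = S * w" if "i < n" for i
    using S[of "2*i + 1"] nodes[OF that] that w by simp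
  have "integral {x (2*i + 1 - 1)..x (2*i + 1 + 1)}
          (\<lambda>t. kernelT x h k (2*i + 1) t * nderiv_within {x (2*i + 1 - 1)..x (2*i + 1 + 1)} k f t)
        = panel_moment f (u i) w k" if "i < n" for i
  proof -
    have "kernelT x h k (2*i + 1) t = (-w) ^ k * unit_kernel k ((t - u i) / w)" for t
    proof -
      have "(t \<le> u i + w/2) = ((t - u i) / w \<le> 1/2)"
        using w by (simp add: field_simps)
      moreover have "(- w) ^ k = (-1) ^ k * (2*h) ^ k"
        unfolding w_def by (metis power_minus)
      ultimately show ?thesis
        using nodes[OF that] kerP_eq_peano[OF k] kerQ_eq_peano_right[OF k]
        by (simp add: kernelT_def unit_kernel_def w_def)
    qed
    then show ?thesis
      using unit_kernel_moment[OF Ck[OF that] w k] nodes[OF that] by (simp add: integral_unique)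
  qed
  then have R: "remainderR n x h k f = (\<Sum>i<n. panel_moment f (u i) w k)"
    unfolding remainderR_def sum_odd_indices by simp
  have total: "\<bar>remainderR n x h k f\<bar> \<le> real n * K"
    if "\<And>i. i < n \<Longrightarrow> \<bar>panel_moment f (u i) w k\<bar> \<le> K" for K
  proof -
    have "\<bar>remainderR n x h k f\<bar> \<le> (\<Sum>i<n. \<bar>panel_moment f (u i) w k\<bar>)"
      unfolding R by (rule sum_abs)
    also have "\<dots> \<le> real n * K"
      using sum_bounded_above[of "{..<n}" "\<lambda>i. \<bar>panel_moment f (u i) w k\<bar>" K] that by simp
    finally show ?thesis .
  qed
  note panel = panel_moment_bounds[OF Ck w k bd]
  have "real n * ((\<Gamma> - \<gamma>) / 2 * (w ^ k * (w * constC k)))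
      = (\<Gamma> - \<gamma>) / 4 * constD k * h ^ k * (b - a)"
    by (simp add: ba w_def constD_def power_mult_distrib)
  then have bound1: "\<bar>remainderR n x h k f\<bar> \<le> (\<Gamma> - \<gamma>) / 4 * constD k * h ^ k * (b - a)"
    using total panel(1) by metis
  have "real n * (w ^ k * constB k * (S * w - \<gamma> * w)) = 1/2 * (S - \<gamma>) * constE k * h ^ k * (b - a)"
    by (simp add: ba w_def constE_def power_mult_distrib algebra_simps)
  moreover have "\<bar>panel_moment f (u i) w k\<bar> \<le> w ^ k * constB k * (S * w - \<gamma> * w)" if "i < n" for i
    using panel(2)[OF that that] S'[OF that] by simp
  ultimately have bound2: "\<bar>remainderR n x h k f\<bar> \<le> 1/2 * (S - \<gamma>) * constE k * h ^ k * (b - a)"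
    using total by metis
  have "real n * (w ^ k * constB k * (\<Gamma> * w - S * w)) = 1/2 * (\<Gamma> - S) * constE k * h ^ k * (b - a)"
    by (simp add: ba w_def constE_def power_mult_distrib algebra_simps)
  moreover have "\<bar>panel_moment f (u i) w k\<bar> \<le> w ^ k * constB k * (\<Gamma> * w - S * w)" if "i < n" for i
    using panel(3)[OF that that] S'[OF that] by simp
  ultimately have bound3: "\<bar>remainderR n x h k f\<bar> \<le> 1/2 * (\<Gamma> - S) * constE k * h ^ k * (b - a)"
    using total by metis
  have quadrature: "integral {a..b} f =
             h / 15 * (\<Sum>j | j \<in> {1..2*n - 1} \<and> odd j. 7 * f (x (j - 1)) + 16 * f (x j) + 7 * f (x (j + 1)))
             - h^2 / 15 * (nderiv_within {a..b} 1 f b - nderiv_within {a..b} 1 f a)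
             + remainderR n x h k f" if diff: "f differentiable_on {a..b}"
  proof -
    define f' where "f' = nderiv_within {a..b} 1 f"
    have sub: "{u i..u i + w} \<subseteq> {a..b}" if "i < n" for i
    proof -
      have "real (Suc i) * w \<le> real n * w" using that w by (intro mult_right_mono) auto
      then show ?thesis using w by (auto simp: u_def ba algebra_simps)
    qed
    have "integral {u i..u i + w} f = h/15 * (7 * f (u i) + 16 * f (u i + w/2) + 7 * f (u i + w))
           - h\<^sup>2 / 15 * (f' (u (Suc i)) - f' (u i)) + panel_moment f (u i) w k" if "i < n" for i
    proof -
      have "?g i 1 t = f' t" if "t \<in> {u i..u i + w}" for t
        unfolding f'_def using w that by (intro nderiv_within_1_subinterval diff sub \<open>i < n\<close>) auto
      from this[of "u i"] this[of "u i + w"] show ?thesis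
        using panel_quadrature[OF Ck[OF that] w k] w by (simp add: u_Suc w_def)
    qed
    moreover have "integral {a..b} f = (\<Sum>i<n. integral {u i..u i + w} f)"
    proof -
      have "f integrable_on {a..b}"
        using diff by (intro integrable_continuous_real differentiable_imp_continuous_on)
      then show ?thesis
        using integral_sum_panels[of f a n w] w by (simp add: ba u_def algebra_simps)
    qed
    ultimately have "integral {a..b} f =
        h/15 * (\<Sum>i<n. 7 * f (u i) + 16 * f (u i + w/2) + 7 * f (u i + w))
        - h\<^sup>2 / 15 * (\<Sum>i<n. f' (u (Suc i)) - f' (u i)) + remainderR n x h k f"
      unfolding R sum_distrib_left by (simp add: sum.distrib sum_subtractf)
    moreover have "(\<Sum>i<n. f' (u (Suc i)) - f' (u i)) = f' b - f' a"
      unfolding sum_lessThan_telescope[of "\<lambda>i. f' (u i)"] by (simp add: u_def ba)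
    moreover have "(\<Sum>i<n. 7 * f (u i) + 16 * f (u i + w/2) + 7 * f (u i + w)) =
        (\<Sum>j | j \<in> {1..2*n - 1} \<and> odd j. 7 * f (x (j - 1)) + 16 * f (x j) + 7 * f (x (j + 1)))"
      unfolding sum_odd_indices by (rule sum.cong) (use nodes in auto)
    ultimately show ?thesis by (simp add: f'_def)
  qed
  show ?thesis using quadrature bound1 bound2 bound3 by blast
qed

end
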